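(* The shift space $Z=\bigcap_{n=1}^\infty Z_n$ is $\bar d$-complete, where $Z_n$ is the sofic shift presented by the labelled graph $G_n$ described in the context.
   Context: Let $\mathscr{A}=\{0,1\}$ and let $\mathscr{A}^\infty$ be the set of sequences $x=\{x_n\}_{n=0}^\infty$ over $\mathscr{A}$. For $n\in\mathbb{N}=\{1,2,\ldots\}$ let $G_n$ be the oriented labelled multigraph with vertex set $\{v_0,v_1,\ldots,v_{10^n-1}\}$ (indices of vertices read modulo $10^n$) and the following labelled edges: (i) for every $0\le k<10^n$ an edge from $v_k$ to $v_{k+1}$ with label $0$; (ii) for every $1\le k\le 10^n-2^n$ an edge from $v_k$ to $v_{k+1}$ with label $1$; (iii) an edge from $v_{10^n-2^n}$ to $v_{10^n-2^n+2}$ with label $0$. $Z_n\subseteq\mathscr{A}^\infty$ is the set of all label sequences of infinite paths in $G_n$ (starting at any vertex). For $x,y\in\mathscr{A}^\infty$ let $\bar d(x,y)=\limsup_{n\to\infty}\frac1n|\{i\in[0,n): x_i\ne y_i\}|$ (a pseudometric). A set $X\subseteq\mathscr{A}^\infty$ is $\bar d$-complete if for every sequence $\{z^{(n)}\}_{n=1}^\infty\subset X$ that is Cauchy for $\bar d$ there is $z\in X$ with $\lim_{n\to\infty}\bar d(z^{(n)},z)=0$. *)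

theory Defs
  imports "HOL-Library.Z2" "HOL-Analysis.Analysis"
begin

text \<open>The alphabet is the two-element type \<open>bit\<close>, so \<open>UNIV\<close> is the full shift over \<open>{0, 1}\<close>.\<close>

type_synonym bseq = "nat \<Rightarrow> bit"

text \<open>
  A labelled multigraph is given by its edges, encoded as triples (source, label, target).
\<close>

definition label_sequences :: "('v \<times> 'a \<times> 'v) set \<Rightarrow> (nat \<Rightarrow> 'a) set"
  where "label_sequences E = {x. \<exists>p. \<forall>i. (p i, x i, p (Suc i)) \<in> E}"

text \<open>
  The vertex \<open>v\<^sub>k\<close> of \<open>G\<^sub>n\<close> is encoded as the number \<open>k < 10 ^ n\<close>. For \<open>n \<ge> 1\<close> no two edges
  of \<open>G\<^sub>n\<close> share source, target and label, so the set of triples loses no multiplicities.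
\<close>

definition G_edges :: "nat \<Rightarrow> (nat \<times> bit \<times> nat) set"
  where "G_edges n =
      {(k, 0, (k + 1) mod 10 ^ n) | k. k < 10 ^ n}
    \<union> {(k, 1, (k + 1) mod 10 ^ n) | k. 1 \<le> k \<and> k \<le> 10 ^ n - 2 ^ n}
    \<union> {(10 ^ n - 2 ^ n, 0, (10 ^ n - 2 ^ n + 2) mod 10 ^ n)}"

definition Zn :: "nat \<Rightarrow> bseq set"
  where "Zn n = label_sequences (G_edges n)"

definition Z :: "bseq set"
  where "Z = (\<Inter>n\<in>{1..}. Zn n)"

text \<open>Extended-real valued because \<open>limsup\<close> needs a complete lattice; all values lie in \<open>[0, 1]\<close>.\<close>

definition dbar :: "bseq \<Rightarrow> bseq \<Rightarrow> ereal"
  where "dbar x y = limsup (\<lambda>n. ereal (real (card {i. i < n \<and> x i \<noteq> y i}) / real n))"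

definition dbar_Cauchy :: "(nat \<Rightarrow> bseq) \<Rightarrow> bool"
  where "dbar_Cauchy z \<longleftrightarrow>
    (\<forall>e::real. e > 0 \<longrightarrow> (\<exists>N. \<forall>m\<ge>N. \<forall>n\<ge>N. dbar (z m) (z n) < ereal e))"

definition dbar_complete :: "bseq set \<Rightarrow> bool"
  where "dbar_complete X \<longleftrightarrow>
    (\<forall>z. (\<forall>n. z n \<in> X) \<and> dbar_Cauchy z \<longrightarrow>
      (\<exists>x\<in>X. (\<lambda>n. dbar (z n) x) \<longlonglongrightarrow> 0))"

end

theory Submission
  imports Defs
begin

text \<open>
  Deleting ones from a point of \<open>Z\<close> gives a point of \<open>Z\<close>, since every edge of \<open>G\<^sub>n\<close> has a
  parallel edge labelled \<open>0\<close>. The limit of a Cauchy sequence \<open>z\<close> therefore arises by following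
  \<open>z\<^sub>j\<close> on \<open>[N\<^sub>j, N\<^sub>j\<^sub>+\<^sub>1)\<close>, with \<open>N\<close> growing fast, and writing \<open>0\<close> wherever a chosen walk \<open>P\<^sub>n\<close>
  in some \<open>G\<^sub>n\<close> forbids a \<open>1\<close>. On \<open>[0, N\<^sub>n]\<close> the walk \<open>P\<^sub>n\<close> goes round the cycle without
  shortcuts; this costs density of order \<open>5\<^sup>-\<^sup>n\<close> and nothing before time \<open>10\<^sup>n - 2\<^sup>n\<close>. Later, for
  each \<open>j \<ge> n\<close>, it is steered after time \<open>N\<^sub>j\<close> onto a walk presenting \<open>z\<^sub>j\<close>. The shortcut edge
  makes this possible within \<open>2 \<cdot> 100\<^sup>n\<close> steps, which is negligible compared with \<open>N\<^sub>j\<close>.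
\<close>

section \<open>Walks in the graphs and the shortcuts they take\<close>

text \<open>Labels are disregarded: every edge of \<open>G\<^sub>n\<close> is parallel to an edge labelled \<open>0\<close>.\<close>

definition walk :: "nat \<Rightarrow> (nat \<Rightarrow> nat) \<Rightarrow> bool"
  where "walk n p \<longleftrightarrow> (\<forall>i. (p i, 0, p (Suc i)) \<in> G_edges n)"

lemma G_edges_zero_iff:
  "(k, 0, l) \<in> G_edges n \<longleftrightarrow>
    k < 10 ^ n \<and> l = (k + 1) mod 10 ^ n \<or> k = 10 ^ n - 2 ^ n \<and> l = (k + 2) mod 10 ^ n"
  by (auto simp: G_edges_def)

lemma G_edges_one_iff:
  "(k, 1, l) \<in> G_edges n \<longleftrightarrow> 1 \<le> k \<and> k \<le> 10 ^ n - 2 ^ n \<and> l = (k + 1) mod 10 ^ n"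
  by (auto simp: G_edges_def)

lemma zero_edge_if_edge:
  assumes "(k, b, l) \<in> G_edges n"
  shows "(k, 0, l) \<in> G_edges n"
proof (cases b)
  case zero
  then show ?thesis using assms by simp
next
  case one
  have "10 ^ n - 2 ^ n < (10 ^ n :: nat)" by simp
  then have "k < 10 ^ n" if "k \<le> 10 ^ n - 2 ^ n" using that by linarith
  then show ?thesis
    using assms one unfolding G_edges_zero_iff by (auto simp: G_edges_one_iff)
qed

lemma walk_less:
  assumes "walk n p"
  shows "p i < 10 ^ n"
proof -
  have "10 ^ n - 2 ^ n < (10 ^ n :: nat)" by simp
  then show ?thesis
    using assms[unfolded walk_def, rule_format, of i] unfolding G_edges_zero_iff by auto
qed

lemma walk_splice:
  assumes "walk n p" "walk n q" "p t = q s"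
  shows "walk n (\<lambda>i. if i \<le> t then p i else q (i - t + s))"
proof -
  let ?r = "\<lambda>i. if i \<le> t then p i else q (i - t + s)"
  have "(?r i, 0, ?r (Suc i)) \<in> G_edges n" for i
  proof (cases "i < t")
    case True
    then show ?thesis using assms(1) by (simp add: walk_def)
  next
    case False
    then have "?r i = q (i - t + s)" "?r (Suc i) = q (Suc (i - t + s))"
      using assms(3) by (auto simp: Suc_diff_le not_less)
    then show ?thesis using assms(2) by (simp add: walk_def)
  qed
  then show ?thesis by (simp add: walk_def)
qed

text \<open>A step advances by one, or by two along the shortcut, and \<open>E\<close> sums the
  surplus. Modulo \<open>10 ^ n\<close> the position thus depends only on the start, the time and
  the number of shortcuts taken.\<close>

lemma walk_excess:
  assumes "walk n p"
  obtains E where "E 0 = 0" "\<And>i. E i \<le> E (Suc i)" "\<And>i. E (Suc i) \<le> Suc (E i)"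
    "\<And>i. p i = (p 0 + i + E i) mod 10 ^ n"
proof -
  define e where "e i = (if p (Suc i) = (p i + 1) mod 10 ^ n then 0 else 1 :: nat)" for i
  define E where "E i = (\<Sum>k<i. e k)" for i
  have step: "p (Suc i) = (p i + 1 + e i) mod 10 ^ n" for i
    using assms[unfolded walk_def, rule_format, of i]
    unfolding G_edges_zero_iff by (auto simp: e_def)
  have "p i = (p 0 + i + E i) mod 10 ^ n" for i
  proof (induction i)
    case 0
    then show ?case using walk_less[OF assms] by (simp add: E_def)
  next
    case (Suc i)
    have "p (Suc i) = ((p 0 + i + E i) mod 10 ^ n + (1 + e i)) mod 10 ^ n"
      using step[of i] Suc by (simp add: add.assoc)
    also have "\<dots> = (p 0 + Suc i + E (Suc i)) mod 10 ^ n"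
      unfolding mod_add_left_eq by (simp add: E_def add_ac)
    finally show ?case .
  qed
  then show ?thesis
    by (rule that[rotated 3]) (auto simp: E_def e_def)
qed

lemma exists_mod_eq:
  fixes a b L :: nat
  assumes "0 < L"
  obtains v where "v < L" "(a + v) mod L = b mod L"
proof -
  have "int ((a + nat ((int b - int a) mod int L)) mod L) = int (b mod L)"
    using assms by (simp add: zmod_int mod_add_right_eq)
  then have "(a + nat ((int b - int a) mod int L)) mod L = b mod L"
    by (simp only: of_nat_eq_iff)
  moreover have "nat ((int b - int a) mod int L) < L"
    using assms by (simp add: nat_less_iff)
  ultimately show ?thesis using that by blast
qed

text \<open>A stretch of \<open>10 ^ n\<close> steps without the shortcut would run through the
  whole cycle and so visit the source of the shortcut, where \<open>shortcut\<close> forces it to be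
  taken. Hence the excess grows in every such stretch.\<close>

lemma shortcut_excess:
  assumes "n \<ge> 1"
    and shortcut: "\<And>i. p i = 10 ^ n - 2 ^ n \<Longrightarrow> p (Suc i) = (p i + 2) mod 10 ^ n"
    and mono: "\<And>i. E i \<le> E (Suc i)"
    and E: "\<And>i. p i = (p 0 + i + E i) mod 10 ^ n"
  shows "E (m * 10 ^ n) \<ge> m"
proof -
  define L where "L = (10 ^ n :: nat)"
  have "(10::nat) ^ 1 \<le> 10 ^ n" using assms(1) by (intro power_increasing) auto
  then have L: "L \<ge> 10" by (simp add: L_def)
  have incr: "E i \<le> E j" if "i \<le> j" for i j
    using mono that by (rule lift_Suc_mono_le)
  have "E (i + L) \<ge> Suc (E i)" for i
  proof (rule ccontr)
    assume "\<not> Suc (E i) \<le> E (i + L)"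
    \<comment> \<open>By monotonicity the excess is constant on the window, so the walk advances
      there by unit steps.\<close>
    then have const: "E (i + k) = E i" if "k \<le> L" for k
      using incr[of i "i + k"] incr[of "i + k" "i + L"] that by simp
    obtain k where k: "k < L" "(p i + k) mod L = (L - 2 ^ n) mod L"
      using exists_mod_eq L by (metis less_le_trans zero_less_numeral)
    have eq: "p (i + l) = (p i + l) mod L" if "l \<le> L" for l
    proof -
      have "p (i + l) = ((p 0 + i + E i) + l) mod L"
        using E[of "i + l"] const[OF that] by (simp add: L_def add_ac)
      also have "\<dots> = (p i + l) mod L"
        using E[of i] by (simp add: L_def mod_add_left_eq)
      finally show ?thesis .
    qed
    have c: "p (i + k) = L - 2 ^ n" using eq[of k] k by (simp add: L_def)
    then have "p (Suc (i + k)) = (p (i + k) + 2) mod L"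
      using shortcut by (simp add: L_def)
    moreover have "p (Suc (i + k)) = (p (i + k) + 1) mod L"
    proof -
      have "p (Suc (i + k)) = ((p i + k) mod L + 1) mod L"
        using eq[of "Suc k"] k(1) by (simp add: mod_Suc_eq)
      then show ?thesis using eq[of k] k by (metis less_imp_le)
    qed
    \<comment> \<open>One step and two steps forward from the same vertex would coincide, which is
      impossible modulo \<open>L\<close>.\<close>
    ultimately have "(p (i + k) + 1 + 1) mod L = (p (i + k) + 1) mod L"
      by simp
    then show False
      using L by (simp add: mod_Suc split: if_splits)
  qed
  then have "E (m * L) \<ge> m"
  proof (induction m)
    case (Suc m)
    have "Suc m \<le> Suc (E (m * L))" using Suc by simp
    also have "\<dots> \<le> E (m * L + L)" by (rule Suc.prems)
    finally show ?case by (simp add: add.commute)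
  qed simp
  then show ?thesis by (simp add: L_def)
qed

section \<open>Steering one walk onto another\<close>

text \<open>
  The excess \<open>E i\<close> of \<open>walk_excess\<close> counts the shortcuts taken in the first \<open>i\<close> steps, so the
  difference of two excesses changes by at most one per step and attains all intermediate values.
  If the walk \<open>q\<close> takes few shortcuts, the walk that always takes them catches up with it;
  otherwise \<open>q\<close> catches up with the walk that takes none.
\<close>

lemma exists_meeting_walk:
  assumes "n \<ge> 1" "walk n q" "a < 10 ^ n"
  obtains p t where "walk n p" "p 0 = a" "t \<le> 2 * 100 ^ n" "p t = q t"
proof -
  define L where "L = (10 ^ n :: nat)"
  \<comment> \<open>In \<open>2 * L\<close> windows of length \<open>L\<close> the walk that always
    takes the shortcut collects excess at least \<open>2 * L\<close>. This leads by more than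
    \<open>L\<close> over a walk with excess below \<open>L\<close>.\<close>
  define T where "T = 2 * L * L"
  have T: "T = 2 * 100 ^ n" by (simp add: T_def L_def flip: power_mult_distrib)
  have L: "0 < L" by (simp add: L_def)
  obtain E where E: "E 0 = 0" "\<And>i. E i \<le> E (Suc i)" "\<And>i. E (Suc i) \<le> Suc (E i)"
    "\<And>i. q i = (q 0 + i + E i) mod L"
    using walk_excess[OF assms(2)] unfolding L_def by metis
  show ?thesis
  proof (cases "L \<le> E T")
    case True
    \<comment> \<open>\<open>v\<close> is the offset from the start of \<open>q\<close> to
      \<open>a\<close>; once the excess of \<open>q\<close> equals \<open>v\<close>, it meets the
      walk from \<open>a\<close> without shortcuts.\<close>
    obtain v where v: "v < L" "(q 0 + v) mod L = a mod L"
      using exists_mod_eq[OF L] by metis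
    have "\<exists>t\<le>T. int (E t) = int v"
    proof (rule nat_intermed_int_val[of 0 T, simplified])
      show "\<forall>i. i < T \<longrightarrow> \<bar>int (E (Suc i)) - int (E i)\<bar> \<le> 1"
      proof (intro allI impI)
        fix i show "\<bar>int (E (Suc i)) - int (E i)\<bar> \<le> 1" using E(2,3)[of i] by linarith
      qed
    qed (use E(1) v True in auto)
    then obtain t where t: "t \<le> T" "E t = v" by auto
    define p where "p i = (a + i) mod L" for i
    have "walk n p"
      unfolding walk_def G_edges_zero_iff p_def L_def by (auto simp: mod_Suc_eq)
    moreover have "p 0 = a" using assms(3) by (simp add: p_def L_def)
    moreover have "p t = q t"
    proof -
      have "q t = (q 0 + v + t) mod L" using E(4)[of t] t by (simp add: add_ac)
      also have "\<dots> = (a + t) mod L" using v(2) by (metis mod_add_left_eq)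
      finally show ?thesis by (simp add: p_def)
    qed
    ultimately show ?thesis using that t(1) T by simp
  next
    case False
    define f where "f v = (if v = L - 2 ^ n then (v + 2) mod L else (v + 1) mod L)" for v
    define p where "p i = (f ^^ i) a" for i
    have p0: "p 0 = a" and pSuc: "p (Suc i) = f (p i)" for i by (simp_all add: p_def)
    have pL: "p i < L" for i
      by (induction i) (use assms(3) L in \<open>simp_all add: p0 pSuc f_def L_def\<close>)
    have walk: "walk n p"
      unfolding walk_def G_edges_zero_iff pSuc f_def using pL by (auto simp: L_def)
    obtain F where F: "F 0 = 0" "\<And>i. F i \<le> F (Suc i)" "\<And>i. F (Suc i) \<le> Suc (F i)"
      "\<And>i. p i = (p 0 + i + F i) mod L"
      using walk_excess[OF walk] unfolding L_def by metis
    have FT: "2 * L \<le> F T"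
      unfolding T_def L_def
    proof (rule shortcut_excess[OF assms(1)])
      show "p (Suc i) = (p i + 2) mod 10 ^ n" if "p i = 10 ^ n - 2 ^ n" for i
        using that by (simp add: pSuc f_def L_def)
    qed (use F(2,4) in \<open>unfold L_def\<close>)
    obtain v where v: "v < L" "(a + v) mod L = q 0 mod L"
      using exists_mod_eq[OF L] by metis
    \<comment> \<open>The difference starts at 0 and at time \<open>T\<close> exceeds
      \<open>L\<close>, hence \<open>v\<close>.\<close>
    have "\<exists>t\<le>T. int (F t) - int (E t) = int v"
    proof (rule nat_intermed_int_val[of 0 T, simplified])
      show "\<forall>i. i < T \<longrightarrow> \<bar>int (F (Suc i)) - int (E (Suc i)) - (int (F i) - int (E i))\<bar> \<le> 1"
      proof (intro allI impI)
        fix i show "\<bar>int (F (Suc i)) - int (E (Suc i)) - (int (F i) - int (E i))\<bar> \<le> 1"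
          using E(2,3)[of i] F(2,3)[of i] by linarith
      qed
    qed (use E(1) F(1) v False FT in auto)
    then obtain t where t: "t \<le> T" "F t = E t + v" by auto
    have "p t = (a + v + (t + E t)) mod L" using F(4)[of t] t p0 by (simp add: add_ac)
    also have "\<dots> = (q 0 + (t + E t)) mod L" using v(2) by (metis mod_add_left_eq)
    also have "\<dots> = q t" using E(4)[of t] by (simp add: add_ac)
    finally show ?thesis using that[OF walk p0] t(1) T by simp
  qed
qed

text \<open>From \<open>p N\<close> a meeting walk leads to \<open>q\<close> shifted by
  \<open>N\<close>, which is followed from then on. The delay depends on \<open>n\<close> only,
  neither on \<open>N\<close> nor on the walks.\<close>

lemma walk_merge:
  assumes "n \<ge> 1" "walk n p" "walk n q"
  obtains r where "walk n r" "\<And>i. i \<le> N \<Longrightarrow> r i = p i"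
    "\<And>i. i \<ge> N + 2 * 100 ^ n \<Longrightarrow> r i = q i"
proof -
  have "walk n (\<lambda>i. q (i + N))" using assms(3) by (simp add: walk_def)
  then obtain s t where s: "walk n s" "s 0 = p N" "t \<le> 2 * 100 ^ n" "s t = q (t + N)"
    by (rule exists_meeting_walk[OF assms(1) _ walk_less[OF assms(2), of N]])
  define u where "u i = (if i \<le> t then s i else q (i - t + (t + N)))" for i
  define r where "r i = (if i \<le> N then p i else u (i - N + 0))" for i
  have "walk n u" unfolding u_def by (rule walk_splice[OF s(1) assms(3) s(4)])
  then have "walk n r" unfolding r_def
    using s(2) by (intro walk_splice[OF assms(2), of u N 0]) (simp_all add: u_def)
  moreover have "r i = q i" if i: "i \<ge> N + 2 * 100 ^ n" for i
  proof -
    have "(0::nat) < 2 * 100 ^ n" by simp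
    then have "N < i" using i by linarith
    moreover have "t \<le> i - N" using i s(3) by simp
    ultimately show ?thesis using s(4) by (auto simp: r_def u_def)
  qed
  ultimately show ?thesis using that[of r] by (auto simp: r_def)
qed

text \<open>Merging successively at \<open>N n\<close>, \<open>N (n + 1)\<close>, and so on gives
  walks \<open>r k\<close>. Each merge leaves earlier times untouched, so the \<open>r k\<close>
  stabilise pointwise.\<close>

lemma walk_chain:
  fixes N :: "nat \<Rightarrow> nat"
  assumes "n \<ge> 1" "walk n d" "\<And>j. walk n (q j)" "strict_mono N"
  obtains P where "walk n P" "\<And>i. i \<le> N n \<Longrightarrow> P i = d i"
    "\<And>j i. \<lbrakk>n \<le> j; N j + 2 * 100 ^ n \<le> i; i \<le> N (Suc j)\<rbrakk> \<Longrightarrow> P i = q j i"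
proof -
  have "\<exists>r. \<forall>k. (walk n (r k) \<and> (k = 0 \<longrightarrow> r k = d)) \<and>
      ((\<forall>i\<le>N (n + k). r (Suc k) i = r k i) \<and>
       (\<forall>i\<ge>N (n + k) + 2 * 100 ^ n. r (Suc k) i = q (n + k) i))"
  proof (rule dependent_nat_choice, goal_cases)
    case 1
    then show ?case using assms(2) by blast
  next
    case (2 r k)
    then show ?case using walk_merge[OF assms(1) _ assms(3)] by (metis nat.distinct(1))
  qed
  then obtain r where r: "\<And>k. walk n (r k)" "r 0 = d"
    "\<And>k i. i \<le> N (n + k) \<Longrightarrow> r (Suc k) i = r k i"
    "\<And>k i. i \<ge> N (n + k) + 2 * 100 ^ n \<Longrightarrow> r (Suc k) i = q (n + k) i"
    by metis
  have mono: "N i \<le> N j" if "i \<le> j" for i j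
    using assms(4) that by (simp add: strict_mono_less_eq)
  have stable: "r (k + l) i = r k i" if "i \<le> N (n + k)" for k l i
  proof (induction l)
    case (Suc l)
    have "i \<le> N (n + (k + l))" using that mono[of "n + k" "n + (k + l)"] by simp
    then show ?case using r(3) Suc by simp
  qed simp
  \<comment> \<open>Since \<open>i \<le> N (n + i)\<close>, the value at time \<open>i\<close> is
    final from stage \<open>i\<close> on.\<close>
  define P where "P i = r i i" for i
  have ge: "i \<le> N (n + i)" for i
    using seq_suble[OF assms(4), of "n + i"] by simp
  have P: "P i = r k i" if "i \<le> N (n + k)" for i k
    using stable[OF that, of i] stable[OF ge, of i k] by (simp add: P_def add.commute)
  have "walk n P"
    unfolding walk_def
  proof
    fix i
    have "Suc i \<le> N (n + Suc i)" by (rule ge)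
    then have "P i = r (Suc i) i" "P (Suc i) = r (Suc i) (Suc i)" by (intro P; simp)+
    then show "(P i, 0, P (Suc i)) \<in> G_edges n" using r(1) by (simp add: walk_def)
  qed
  moreover have "P i = d i" if "i \<le> N n" for i
    using P[of i 0] that r(2) by simp
  moreover have "P i = q j i" if "n \<le> j" "N j + 2 * 100 ^ n \<le> i" "i \<le> N (Suc j)" for i j
    using P[of i "Suc (j - n)"] r(4)[of "j - n" i] that by simp
  ultimately show ?thesis using that by blast
qed

section \<open>Times at which the walk without shortcuts forbids a one\<close>

text \<open>Starting at \<open>v_1\<close> instead of \<open>v_0\<close> moves all times without a
  parallel edge labelled 1 to the end of each period, so none occurs before
  \<open>10 ^ n - 2 ^ n\<close>.\<close>

lemma default_walk: "walk n (\<lambda>i. (i + 1) mod 10 ^ n)"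
  unfolding walk_def G_edges_zero_iff by (auto simp: mod_Suc_eq)

lemma default_walk_one_edge:
  assumes "i mod 10 ^ n < 10 ^ n - 2 ^ n"
  shows "((i + 1) mod 10 ^ n, 1, (Suc i + 1) mod 10 ^ n) \<in> G_edges n"
proof -
  have "Suc (i mod 10 ^ n) < 10 ^ n"
  proof -
    have "(1::nat) \<le> 2 ^ n" by simp
    then show ?thesis using assms by linarith
  qed
  then have "(i + 1) mod 10 ^ n = Suc (i mod 10 ^ n)" by (simp add: mod_Suc)
  moreover have "(Suc i + 1) mod 10 ^ n = ((i + 1) mod 10 ^ n + 1) mod 10 ^ n"
    by (simp add: mod_Suc_eq)
  ultimately show ?thesis using assms unfolding G_edges_one_iff by simp
qed

text \<open>Each period has \<open>2 ^ n\<close> marked times, all in its second half. A period with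
  a marked time below \<open>M\<close> thus has at least half its length below \<open>M\<close>,
  which bounds the number of such periods by \<open>2 * M div L\<close>, the incomplete one
  included.\<close>

lemma card_markers_le:
  assumes "n \<ge> 1"
  shows "real (card {i. i < M \<and> i mod 10 ^ n \<ge> 10 ^ n - 2 ^ n}) \<le> 2 * real M / 5 ^ n"
proof -
  define L where "L = (10 ^ n :: nat)"
  define c where "c = L - 2 ^ n"
  have L5: "L = 5 ^ n * 2 ^ n" by (simp add: L_def flip: power_mult_distrib)
  have "(5::nat) ^ 1 \<le> 5 ^ n" using assms by (intro power_increasing) auto
  then have "5 * 2 ^ n \<le> L" unfolding L5 by (intro mult_right_mono) auto
  then have c: "L \<le> 2 * c" by (simp add: c_def)
  have L: "0 < L" by (simp add: L_def)
  have "{i. i < M \<and> i mod L \<ge> c} \<subseteq> (\<lambda>(a, b). a * L + b) ` ({..<2 * M div L} \<times> {c..<L})"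
  proof
    fix i assume i: "i \<in> {i. i < M \<and> i mod L \<ge> c}"
    have eq: "i = i div L * L + i mod L" by simp
    have "i div L * L + c < M"
    proof -
      have "c \<le> i mod L" "i < M" using i by simp_all
      then show ?thesis using eq by linarith
    qed
    then have "Suc (i div L) * L \<le> 2 * M" using c by simp
    then have "Suc (i div L) \<le> 2 * M div L" using L by (simp add: less_eq_div_iff_mult_less_eq)
    moreover have "i mod L < L" using L by simp
    ultimately show "i \<in> (\<lambda>(a, b). a * L + b) ` ({..<2 * M div L} \<times> {c..<L})"
      using i eq by (intro image_eqI[of _ _ "(i div L, i mod L)"]) auto
  qed
  then have "card {i. i < M \<and> i mod L \<ge> c} \<le> card ({..<2 * M div L} \<times> {c..<L})"
    by (rule surj_card_le[rotated]) simp
  also have "\<dots> = (2 * M div L) * 2 ^ n"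
    unfolding card_cartesian_product c_def L5 by simp
  finally have "real (card {i. i < M \<and> i mod L \<ge> c}) \<le> real ((2 * M div L) * 2 ^ n)"
    by (simp only: of_nat_le_iff)
  also have "\<dots> = real (2 * M div L) * 2 ^ n" by simp
  also have "\<dots> \<le> real (2 * M) / real L * 2 ^ n"
    by (intro mult_right_mono of_nat_div_le_of_nat) simp
  also have "\<dots> = 2 * real M / 5 ^ n" by (simp add: L5)
  finally show ?thesis by (simp add: L_def c_def)
qed

text \<open>The bounds of the single levels form a geometric series with sum
  \<open>5 / 2 * M / 5 ^ j\<close>, rounded up to the factor 3.\<close>

lemma card_all_markers_le:
  assumes "j \<ge> 1"
  shows "real (card {i. i < M \<and> (\<exists>n\<ge>j. i mod 10 ^ n \<ge> 10 ^ n - 2 ^ n)}) \<le> 3 * real M / 5 ^ j"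
proof -
  have geom: "(\<Sum>n=j..<j + K. 1 / 5 ^ n) = (5 / 4) * (1 / 5 ^ j - 1 / 5 ^ (j + K) :: real)" for K
  proof (induction K)
    case (Suc K)
    have "1 / 5 ^ (j + Suc K) = 1 / 5 ^ (j + K) / (5 :: real)" by simp
    then show ?case using Suc by simp
  qed simp
  let ?D = "\<lambda>n. {i. i < M \<and> i mod 10 ^ n \<ge> 10 ^ n - 2 ^ n}"
  have "{i. i < M \<and> (\<exists>n\<ge>j. i mod 10 ^ n \<ge> 10 ^ n - 2 ^ n)} \<subseteq> (\<Union>n\<in>{j..<j + M}. ?D n)"
  proof
    fix i assume "i \<in> {i. i < M \<and> (\<exists>n\<ge>j. i mod 10 ^ n \<ge> 10 ^ n - 2 ^ n)}"
    then obtain n where n: "i < M" "n \<ge> j" "i mod 10 ^ n \<ge> 10 ^ n - 2 ^ n" by auto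
    \<comment> \<open>The first marked time of level \<open>n\<close> exceeds \<open>n\<close>, so
      only levels below \<open>M\<close> matter and the union is finite.\<close>
    have "n < 2 ^ n" by simp
    also have "(2::nat) ^ n \<le> 10 ^ n - 2 ^ n"
    proof -
      have "(2::nat) ^ n * 5 ^ 1 \<le> 2 ^ n * 5 ^ n"
        using assms n(2) by (intro mult_left_mono power_increasing) auto
      also have "\<dots> = 10 ^ n" by (simp flip: power_mult_distrib)
      finally show ?thesis by simp
    qed
    also have "\<dots> \<le> i mod 10 ^ n" by (rule n)
    also have "\<dots> \<le> i" by simp
    finally show "i \<in> (\<Union>n\<in>{j..<j + M}. ?D n)" using n by auto
  qed
  then have "card {i. i < M \<and> (\<exists>n\<ge>j. i mod 10 ^ n \<ge> 10 ^ n - 2 ^ n)} \<le> card (\<Union>n\<in>{j..<j + M}. ?D n)"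
    by (intro card_mono) auto
  also have "\<dots> \<le> (\<Sum>n=j..<j + M. card (?D n))" by (intro card_UN_le) simp
  finally have "real (card {i. i < M \<and> (\<exists>n\<ge>j. i mod 10 ^ n \<ge> 10 ^ n - 2 ^ n)})
      \<le> (\<Sum>n=j..<j + M. real (card (?D n)))"
    by (simp flip: of_nat_sum)
  also have "\<dots> \<le> (\<Sum>n=j..<j + M. 2 * real M * (1 / 5 ^ n))"
    using assms by (intro sum_mono) (use card_markers_le in auto)
  also have "\<dots> = 2 * real M * ((5 / 4) * (1 / 5 ^ j - 1 / 5 ^ (j + M)))"
    unfolding sum_distrib_left[symmetric] geom ..
  also have "\<dots> \<le> 2 * real M * ((5 / 4) * (1 / 5 ^ j))"
    by (intro mult_left_mono) auto
  also have "\<dots> \<le> 3 * real M / 5 ^ j"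
    by (simp add: field_simps)
  finally show ?thesis .
qed

section \<open>Mismatch counts over finite times\<close>

definition mismatches :: "bseq \<Rightarrow> bseq \<Rightarrow> nat \<Rightarrow> nat"
  where "mismatches x y M = card {i. i < M \<and> x i \<noteq> y i}"

lemma dbar_eq: "dbar x y = limsup (\<lambda>M. ereal (real (mismatches x y M) / real M))"
  by (simp add: dbar_def mismatches_def)

lemma mismatches_le: "mismatches x y M \<le> M"
proof -
  have "card {i. i < M \<and> x i \<noteq> y i} \<le> card {..<M}" by (intro card_mono) auto
  then show ?thesis by (simp add: mismatches_def)
qed

lemma dbar_nonneg: "0 \<le> dbar x y"
  unfolding dbar_eq by (intro le_Limsup) auto

lemma dbar_le_1: "dbar x y \<le> 1"
  unfolding dbar_eq
proof (intro Limsup_bounded eventuallyI)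
  fix M show "ereal (real (mismatches x y M) / real M) \<le> 1"
    using mismatches_le[of x y M] by (cases "M = 0") (auto simp: divide_simps one_ereal_def)
qed

text \<open>As \<open>dbar\<close> lies between 0 and 1, its conversion to a real loses nothing. The
  form without quotients allows counts to be added.\<close>

lemma eventually_mismatches_le:
  assumes "e > 0"
  shows "\<forall>\<^sub>F M in sequentially. real (mismatches x y M) \<le> (real_of_ereal (dbar x y) + e) * real M"
proof -
  have "dbar x y < ereal (real_of_ereal (dbar x y) + e)"
    using dbar_nonneg[of x y] dbar_le_1[of x y] assms by (cases "dbar x y") auto
  then have "\<forall>\<^sub>F M in sequentially. ereal (real (mismatches x y M) / real M)
      < ereal (real_of_ereal (dbar x y) + e)"
    unfolding dbar_eq[of x y] by (rule Limsup_lessD)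
  then show ?thesis
    using eventually_gt_at_top[of 0]
    by eventually_elim (auto simp: divide_simps mult.commute split: if_splits)
qed

section \<open>Breakpoints and the glued point\<close>

text \<open>At time \<open>N (Suc j)\<close> the times before \<open>N j\<close> have become
  negligible, as has the steering delay of all levels up to \<open>Suc j\<close>. The last property
  makes mismatch frequencies among the first \<open>j + 1\<close> points nearly respect
  \<open>dbar\<close> from \<open>N j\<close> on. Each choice meets finitely many conditions that
  hold for all large values.\<close>

lemma exists_breakpoints:
  fixes z :: "nat \<Rightarrow> bseq"
  obtains N :: "nat \<Rightarrow> nat" where "strict_mono N"
    "\<And>j. (j + 2) * N j \<le> N (Suc j)"
    "\<And>j. (j + 1) * (\<Sum>n\<le>j. 2 * 100 ^ n) \<le> N j"
    "\<And>j a b M. \<lbrakk>a \<le> j; b \<le> j; N j \<le> M\<rbrakk> \<Longrightarrow>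
      real (mismatches (z a) (z b) M) \<le> (real_of_ereal (dbar (z a) (z b)) + 1 / (real j + 1)) * real M"
proof -
  define good where "good j v \<longleftrightarrow> (j + 1) * (\<Sum>n\<le>j. 2 * 100 ^ n) \<le> v \<and>
     (\<forall>M\<ge>v. \<forall>a\<in>{..j}. \<forall>b\<in>{..j}. real (mismatches (z a) (z b) M)
        \<le> (real_of_ereal (dbar (z a) (z b)) + 1 / (real j + 1)) * real M)" for j v :: nat
  have ex: "\<exists>v\<ge>B. good j v" for j B
  proof -
    have "\<forall>\<^sub>F M in sequentially. \<forall>a\<in>{..j}. \<forall>b\<in>{..j}. real (mismatches (z a) (z b) M)
        \<le> (real_of_ereal (dbar (z a) (z b)) + 1 / (real j + 1)) * real M"
      by (intro eventually_ball_finite ballI eventually_mismatches_le) auto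
    then obtain v where v: "\<And>M. M \<ge> v \<Longrightarrow> \<forall>a\<in>{..j}. \<forall>b\<in>{..j}. real (mismatches (z a) (z b) M)
        \<le> (real_of_ereal (dbar (z a) (z b)) + 1 / (real j + 1)) * real M"
      unfolding eventually_sequentially by metis
    show ?thesis
      by (rule exI[of _ "max B (max v ((j + 1) * (\<Sum>n\<le>j. 2 * 100 ^ n)))"])
        (use v in \<open>auto simp: good_def\<close>)
  qed
  have "\<exists>N. \<forall>j. good j (N j) \<and> ((j + 2) * N j \<le> N (Suc j) \<and> N j < N (Suc j))"
  proof (rule dependent_nat_choice, goal_cases)
    case 1
    then show ?case using ex by blast
  next
    case (2 v j)
    obtain u where "u \<ge> (j + 2) * v + Suc v" "good (Suc j) u" using ex by blast
    then show ?case by (intro exI[of _ u]) auto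
  qed
  then obtain N where N: "\<And>j. good j (N j)" "\<And>j. (j + 2) * N j \<le> N (Suc j)"
    "\<And>j. N j < N (Suc j)" by metis
  show ?thesis
    by (rule that[of N]) (use N in \<open>auto simp: strict_mono_Suc_iff good_def\<close>)
qed

lemma exists_piece:
  fixes N :: "nat \<Rightarrow> nat"
  assumes "strict_mono N" "N a \<le> M"
  obtains j where "a \<le> j" "N j \<le> M" "M < N (Suc j)"
proof -
  define k where "k = (LEAST k. M < N k)"
  have "M < N (Suc M)" using seq_suble[OF assms(1), of "Suc M"] by simp
  then have k: "M < N k" unfolding k_def by (rule LeastI)
  then have "a < k" using assms strict_mono_less[OF assms(1)] by (meson le_less_trans)
  moreover from this have "N (k - 1) \<le> M"
    using not_less_Least[of "k - 1" "\<lambda>k. M < N k"] by (simp add: k_def not_less)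
  ultimately show ?thesis using that[of "k - 1"] k by simp
qed

text \<open>A disagreement with \<open>z j\<close> is an erased one, forbidden by some
  \<open>P n\<close>. For \<open>n \<le> j\<close> the walk presents \<open>z j\<close> unless it is
  still being steered; for \<open>n > j\<close> it is still the default walk, so the time is
  marked.\<close>

lemma exists_glued_point:
  assumes z: "\<And>j. z j \<in> Z" and N: "strict_mono N"
  obtains x where "x \<in> Z"
    "\<And>j i. \<lbrakk>N j \<le> i; i < N (Suc j); x i \<noteq> z j i\<rbrakk> \<Longrightarrow>
      (\<exists>n\<le>j. i < N j + 2 * 100 ^ n) \<or> (\<exists>n>j. i mod 10 ^ n \<ge> 10 ^ n - 2 ^ n)"
proof -
  have "\<forall>j n. \<exists>p. n \<ge> 1 \<longrightarrow> (\<forall>i. (p i, z j i, p (Suc i)) \<in> G_edges n)"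
    using z unfolding Z_def Zn_def label_sequences_def by auto
  then obtain q where q: "\<And>j n i. n \<ge> 1 \<Longrightarrow> (q j n i, z j i, q j n (Suc i)) \<in> G_edges n"
    by metis
  have walk_q: "walk n (q j n)" if "n \<ge> 1" for j n
    using q[OF that] zero_edge_if_edge unfolding walk_def by blast
  have "\<exists>P. n \<ge> 1 \<longrightarrow> walk n P \<and> (\<forall>i\<le>N n. P i = (i + 1) mod 10 ^ n) \<and>
     (\<forall>j\<ge>n. \<forall>i. N j + 2 * 100 ^ n \<le> i \<and> i \<le> N (Suc j) \<longrightarrow> P i = q j n i)" for n
  proof (cases "n \<ge> 1")
    case True
    show ?thesis
      by (rule walk_chain[where q = "\<lambda>j. q j n", OF True default_walk walk_q[OF True] N]) blast
  qed auto
  then obtain P where P: "\<And>n. n \<ge> 1 \<Longrightarrow> walk n (P n)"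
    "\<And>n i. \<lbrakk>n \<ge> 1; i \<le> N n\<rbrakk> \<Longrightarrow> P n i = (i + 1) mod 10 ^ n"
    "\<And>n j i. \<lbrakk>n \<ge> 1; j \<ge> n; N j + 2 * 100 ^ n \<le> i; i \<le> N (Suc j)\<rbrakk> \<Longrightarrow> P n i = q j n i"
    by metis
  \<comment> \<open>Times before \<open>N 0\<close> are assigned to \<open>z 0\<close>.\<close>
  define w where "w i = z (LEAST j. i < N (Suc j)) i" for i
  have w: "w i = z j i" if "N j \<le> i" "i < N (Suc j)" for i j
  proof -
    have "(LEAST j. i < N (Suc j)) = j"
    proof (rule Least_equality)
      fix k assume "i < N (Suc k)"
      then have "N j < N (Suc k)" using that by simp
      then show "j \<le> k" by (simp add: strict_mono_less[OF N])
    qed (rule that)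
    then show ?thesis by (simp add: w_def)
  qed
  define x where "x i = (if \<forall>n\<ge>1. (P n i, 1, P n (Suc i)) \<in> G_edges n then w i else 0)" for i
  have "(P n i, x i, P n (Suc i)) \<in> G_edges n" if "n \<ge> 1" for n i
  proof (cases "x i")
    case zero
    then show ?thesis using P(1)[OF that] by (simp add: walk_def)
  next
    case one
    then show ?thesis using that by (auto simp: x_def split: if_splits)
  qed
  then have "x \<in> Z" unfolding Z_def Zn_def label_sequences_def by auto
  moreover have "(\<exists>n\<le>j. i < N j + 2 * 100 ^ n) \<or> (\<exists>n>j. i mod 10 ^ n \<ge> 10 ^ n - 2 ^ n)"
    if i: "N j \<le> i" "i < N (Suc j)" and neq: "x i \<noteq> z j i" for i j
  proof (rule ccontr)
    assume "\<not> ?thesis"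
    then have early: "\<And>n. n \<le> j \<Longrightarrow> N j + 2 * 100 ^ n \<le> i"
      and late: "\<And>n. j < n \<Longrightarrow> i mod 10 ^ n < 10 ^ n - 2 ^ n"
      by (meson not_less)+
    have "x i \<noteq> w i" using neq w[OF i] by simp
    then obtain n where n: "n \<ge> 1" "(P n i, 1, P n (Suc i)) \<notin> G_edges n" and "w i \<noteq> 0"
      unfolding x_def by (auto split: if_splits)
    then have z1: "z j i = 1" using w[OF i] by (cases "w i") auto
    show False
    proof (cases "n \<le> j")
      case True
      have "P n i = q j n i" "P n (Suc i) = q j n (Suc i)"
        using early[OF True] i n(1) True by (auto intro!: P(3))
      then show False using n q[OF n(1), of j i] z1 by simp
    next
      case False
      \<comment> \<open>\<open>P n\<close> follows the default walk up to and including time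
        \<open>N n\<close>, which covers both ends of the edge used at time
        \<open>i < N (Suc j)\<close>.\<close>
      then have "N (Suc j) \<le> N n" using strict_mono_less_eq[OF N] by simp
      then have "P n i = (i + 1) mod 10 ^ n" "P n (Suc i) = (Suc i + 1) mod 10 ^ n"
        using i P(2)[OF n(1)] by simp_all
      then show False using n default_walk_one_edge[OF late] False by simp
    qed
  qed
  ultimately show ?thesis using that by blast
qed

section \<open>Distance to the glued point and completeness\<close>

text \<open>Only the pieces \<open>j\<close> and \<open>Suc j\<close> matter, as earlier times are
  negligible. There \<open>y\<close> is compared with \<open>z j\<close> up to
  \<open>N (Suc j)\<close> and with \<open>z (Suc j)\<close> up to \<open>M\<close>, giving
  \<open>2 * c\<close>. The remaining errors are steering delays and marked times.\<close>

lemma mismatches_glued_le: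
  fixes N :: "nat \<Rightarrow> nat"
  assumes N: "(j + 2) * N j \<le> N (Suc j)"
      "(j + 2) * (\<Sum>n\<le>Suc j. 2 * 100 ^ n) \<le> N (Suc j)"
    and x: "\<And>j i. \<lbrakk>N j \<le> i; i < N (Suc j); x i \<noteq> z j i\<rbrakk> \<Longrightarrow>
      (\<exists>n\<le>j. i < N j + 2 * 100 ^ n) \<or> (\<exists>n>j. i mod 10 ^ n \<ge> 10 ^ n - 2 ^ n)"
    and M: "N (Suc j) \<le> M" "M < N (Suc (Suc j))"
    and c: "0 \<le> c" "real (mismatches (z j) y (N (Suc j))) \<le> c * real (N (Suc j))"
      "real (mismatches (z (Suc j)) y M) \<le> c * real M"
  shows "real (mismatches y x M) \<le> (2 * c + 6 / (real j + 2)) * real M"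
proof -
  define S where "S j = (\<Sum>n\<le>j. 2 * 100 ^ n :: nat)" for j
  \<comment> \<open>Levels from \<open>Suc j\<close> on cover the marked times in both
    pieces.\<close>
  define D where "D = {i. i < M \<and> (\<exists>n\<ge>Suc j. i mod 10 ^ n \<ge> 10 ^ n - 2 ^ n)}"
  define A where "A = {i. i < N (Suc j) \<and> z j i \<noteq> y i}"
  define B where "B = {i. i < M \<and> z (Suc j) i \<noteq> y i}"
  define I where "I = {N j..<N j + S j}"
  define I' where "I' = {N (Suc j)..<N (Suc j) + S (Suc j)}"
  have le_S: "2 * 100 ^ n \<le> S k" if "n \<le> k" for n k
    unfolding S_def using that by (intro member_le_sum[where f = "\<lambda>n. 2 * 100 ^ n"]) auto
  have "{i. i < M \<and> y i \<noteq> x i} \<subseteq> {..<N j} \<union> (A \<union> (B \<union> (I \<union> (I' \<union> D))))"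
  proof
    fix i assume i: "i \<in> {i. i < M \<and> y i \<noteq> x i}"
    consider "i < N j" | "N j \<le> i" "i < N (Suc j)" | "N (Suc j) \<le> i" by linarith
    then show "i \<in> {..<N j} \<union> (A \<union> (B \<union> (I \<union> (I' \<union> D))))"
    proof cases
      case 2
      show ?thesis
      proof (cases "x i = z j i")
        case True
        then show ?thesis using i 2 by (auto simp: A_def)
      next
        case False
        from x[OF 2 False] show ?thesis
        proof (elim disjE exE conjE)
          fix n assume "n \<le> j" "i < N j + 2 * 100 ^ n"
          then have "i \<in> I" using le_S[of n j] 2 by (simp add: I_def)
          then show ?thesis by simp
        qed (use i in \<open>auto simp: D_def Suc_le_eq\<close>)
      qed
    next
      case 3
      have 4: "i < N (Suc (Suc j))" using i M by simp
      show ?thesis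
      proof (cases "x i = z (Suc j) i")
        case True
        then show ?thesis using i 3 by (auto simp: B_def)
      next
        case False
        from x[OF 3 4 False] show ?thesis
        proof (elim disjE exE conjE)
          fix n assume "n \<le> Suc j" "i < N (Suc j) + 2 * 100 ^ n"
          then have "i \<in> I'" using le_S[of n "Suc j"] 3 by (simp add: I'_def)
          then show ?thesis by simp
        next
          fix n assume "Suc j < n" "10 ^ n - 2 ^ n \<le> i mod 10 ^ n"
          then have "i \<in> D" using i by (auto simp: D_def intro!: exI[of _ n])
          then show ?thesis by simp
        qed
      qed
    qed auto
  qed
  then have "mismatches y x M \<le> card ({..<N j} \<union> (A \<union> (B \<union> (I \<union> (I' \<union> D)))))"
    unfolding mismatches_def
    by (intro card_mono) (auto simp: A_def B_def I_def I'_def D_def)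
  also have "\<dots> \<le> card {..<N j} + (card A + (card B + (card I + (card I' + card D))))"
    by (intro card_Un_le[THEN order_trans] add_mono order_refl)
  finally have "real (mismatches y x M)
      \<le> real (N j) + real (card A) + real (card B) + real (S j) + real (S (Suc j)) + real (card D)"
    by (simp add: I_def I'_def flip: of_nat_add)
  \<comment> \<open>The numerator 6 arises as 1 for the times before \<open>N j\<close>, 1 for each
    of the two delays and 3 for the marked times.\<close>
  also have "\<dots> \<le> real M / (real j + 2) + c * real M + c * real M + real M / (real j + 2)
      + real M / (real j + 2) + 3 * (real M / (real j + 2))"
  proof (intro add_mono)
    have le_div: "real k \<le> real M / (real j + 2)" if "(j + 2) * k \<le> N (Suc j)" for k
    proof -
      have "real ((j + 2) * k) \<le> real M" using that M by (simp only: of_nat_le_iff)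
      then show ?thesis by (simp add: field_simps)
    qed
    show "real (N j) \<le> real M / (real j + 2)" by (rule le_div[OF N(1)])
    show S': "real (S (Suc j)) \<le> real M / (real j + 2)"
      using N(2) unfolding S_def by (rule le_div)
    have "S j \<le> S (Suc j)" by (simp add: S_def)
    then show "real (S j) \<le> real M / (real j + 2)" using S' by linarith
    show "real (card A) \<le> c * real M"
      using c(2) mult_left_mono[OF _ c(1), of "real (N (Suc j))" "real M"] M
      by (simp add: A_def mismatches_def)
    show "real (card B) \<le> c * real M" using c(3) by (simp add: B_def mismatches_def)
    have "j + 2 \<le> 5 ^ Suc j" by (induction j) auto
    then have "real (j + 2) \<le> real (5 ^ Suc j)" by (simp only: of_nat_le_iff)
    then have "real M / 5 ^ Suc j \<le> real M / (real j + 2)"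
      by (intro divide_left_mono) (auto intro: mult_pos_pos)
    then show "real (card D) \<le> 3 * (real M / (real j + 2))"
      using card_all_markers_le[of "Suc j" M] by (simp add: D_def)
  qed
  also have "\<dots> = (2 * c + 6 / (real j + 2)) * real M" by (simp add: distrib_right)
  finally show ?thesis .
qed

theorem theorem6p2: "dbar_complete Z"
  unfolding dbar_complete_def
proof (intro allI impI, elim conjE)
  fix z assume z: "\<forall>n. z n \<in> Z" and Cauchy: "dbar_Cauchy z"
  obtain N where N: "strict_mono N" "\<And>j. (j + 2) * N j \<le> N (Suc j)"
    "\<And>j. (j + 1) * (\<Sum>n\<le>j. 2 * 100 ^ n) \<le> N j"
    "\<And>j a b M. \<lbrakk>a \<le> j; b \<le> j; N j \<le> M\<rbrakk> \<Longrightarrow>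
      real (mismatches (z a) (z b) M) \<le> (real_of_ereal (dbar (z a) (z b)) + 1 / (real j + 1)) * real M"
    using exists_breakpoints[of z] by metis
  obtain x where x: "x \<in> Z"
    "\<And>j i. \<lbrakk>N j \<le> i; i < N (Suc j); x i \<noteq> z j i\<rbrakk> \<Longrightarrow>
      (\<exists>n\<le>j. i < N j + 2 * 100 ^ n) \<or> (\<exists>n>j. i mod 10 ^ n \<ge> 10 ^ n - 2 ^ n)"
    by (rule exists_glued_point[of z N]) (use z N(1) in auto)
  have bound: "\<exists>K. \<forall>m\<ge>K. dbar (z m) x \<le> ereal (3 * e)" if "e > 0" for e :: real
  proof -
    obtain K where K: "\<And>m n. \<lbrakk>m \<ge> K; n \<ge> K\<rbrakk> \<Longrightarrow> dbar (z m) (z n) < ereal e"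
      using Cauchy \<open>e > 0\<close> unfolding dbar_Cauchy_def by metis
    have real_K: "real_of_ereal (dbar (z m) (z n)) \<le> e" if "m \<ge> K" "n \<ge> K" for m n
      using K[OF that] dbar_nonneg[of "z m" "z n"] by (cases "dbar (z m) (z n)") auto
    \<comment> \<open>The errors will add up to \<open>8 / (real j + 2)\<close>: 6 from gluing and 2
      from the two copies of \<open>c\<close>.\<close>
    obtain k where k: "8 / e < real k" using reals_Archimedean2 by blast
    have "dbar (z m) x \<le> ereal (3 * e)" if m: "m \<ge> K" for m
      unfolding dbar_eq
    proof (intro Limsup_bounded)
      \<comment> \<open>The successor ensures that a piece \<open>l \<ge> a\<close> has a
        predecessor \<open>j\<close> with \<open>m \<le> j\<close> and
        \<open>k \<le> j\<close>.\<close>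
      define a where "a = Suc (max m k)"
      have "ereal (real (mismatches (z m) x M) / real M) \<le> ereal (3 * e)" if M: "M \<ge> N a" for M
      proof -
        obtain l where l: "a \<le> l" "N l \<le> M" "M < N (Suc l)"
          using exists_piece[OF N(1) M] by blast
        obtain j where j: "l = Suc j" "m \<le> j" "k \<le> j"
          using l(1) unfolding a_def by (cases l) auto
        define c where "c = e + 1 / (real j + 2)"
        \<comment> \<open>This serves for \<open>z j\<close> at time \<open>N (Suc j)\<close> and
          for \<open>z (Suc j)\<close> at time \<open>M\<close>; the Cauchy bound applies because
          \<open>K \<le> m \<le> j\<close>.\<close>
        have close: "real (mismatches (z i) (z m) L) \<le> c * real L"
          if "i \<in> {j, Suc j}" "N (Suc j) \<le> L" for i L
        proof -
          have "real (mismatches (z i) (z m) L)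
              \<le> (real_of_ereal (dbar (z i) (z m)) + 1 / (real (Suc j) + 1)) * real L"
            using that j by (intro N(4)) auto
          also have "\<dots> \<le> c * real L"
            using real_K[of i m] that j m by (intro mult_right_mono) (auto simp: c_def add_ac)
          finally show ?thesis .
        qed
        have "real (mismatches (z m) x M) \<le> (2 * c + 6 / (real j + 2)) * real M"
        proof (rule mismatches_glued_le[where z = z, OF N(2) _ x(2)])
          show "(j + 2) * (\<Sum>n\<le>Suc j. 2 * 100 ^ n) \<le> N (Suc j)" using N(3)[of "Suc j"] by simp
        qed (use l j close \<open>e > 0\<close> in \<open>auto simp: c_def\<close>)
        also have "\<dots> \<le> 3 * e * real M"
        proof (intro mult_right_mono)
          have "8 < e * real k" using k \<open>e > 0\<close> by (simp add: field_simps)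
          also have "\<dots> \<le> e * (real j + 2)" using j \<open>e > 0\<close> by (intro mult_left_mono) auto
          finally have "8 / (real j + 2) \<le> e" by (simp add: field_simps)
          moreover have "2 * c + 6 / (real j + 2) = 2 * e + 8 / (real j + 2)"
            by (simp add: c_def)
          ultimately show "2 * c + 6 / (real j + 2) \<le> 3 * e" by linarith
        qed simp
        finally show ?thesis
          using \<open>e > 0\<close> by (cases "M = 0") (auto simp: divide_simps)
      qed
      then show "\<forall>\<^sub>F M in sequentially. ereal (real (mismatches (z m) x M) / real M) \<le> ereal (3 * e)"
        unfolding eventually_sequentially by blast
    qed
    then show ?thesis by blast
  qed
  have "(\<lambda>n. dbar (z n) x) \<longlonglongrightarrow> 0"
  proof (rule order_tendstoI)
    fix a :: ereal assume "a < 0"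
    then show "\<forall>\<^sub>F n in sequentially. a < dbar (z n) x"
      using dbar_nonneg less_le_trans by (intro always_eventually) blast
  next
    fix a :: ereal assume "0 < a"
    then obtain e where e: "0 < ereal e" "ereal e < a" using ereal_dense2 by blast
    then obtain K where K: "\<And>m. m \<ge> K \<Longrightarrow> dbar (z m) x \<le> ereal (3 * (e / 3))"
      using bound[of "e / 3"] by auto
    show "\<forall>\<^sub>F n in sequentially. dbar (z n) x < a"
      using eventually_ge_at_top[of K]
    proof eventually_elim
      case (elim n)
      then show ?case using K[of n] e(2) by simp
    qed
  qed
  then show "\<exists>x\<in>Z. (\<lambda>n. dbar (z n) x) \<longlonglongrightarrow> 0" using x(1) by blast
qed

end
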